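(* Let $u=x_1^{a_1}\cdots x_n^{a_n}$ and $v=x_q^{b_q}\cdots x_n^{b_n}$, where $1\leq q\leq n$ and $a_1,b_q>0$, be two monomials of degree $d\ge 2$ in $S=k[x_1,\ldots,x_n]$ such that $u\geq_{lex}v$, and let $I$ be the lexsegment ideal generated by $\mathcal{L}(u,v)$. Assume that $I\neq\mathfrak{m}^d$, where $\mathfrak{m}=(x_1,\ldots,x_n)$. Then $$\dim(S/I)=\begin{cases} n-q, & \text{if } 1\leq q<n,\\ 1, & \text{if } q=n.\end{cases}$$
   Context: $S=k[x_1,\ldots,x_n]$ is a polynomial ring over a field $k$, with monomials ordered lexicographically with $x_1>x_2>\cdots>x_n$. $d\geq 2$ is an integer and $\mathcal{M}_d$ is the set of monomials of degree $d$ in $S$. For $u,v\in\mathcal{M}_d$ with $u\geq_{lex}v$, $\mathcal{L}(u,v)=\{w\in\mathcal{M}_d : u\geq_{lex}w\geq_{lex}v\}$; the ideal it generates is a lexsegment ideal. $\dim$ denotes Krull dimension. *)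

theory Defs
  imports
    "HOL-Algebra.QuotRing"
    "HOL-Algebra.Ideal_Product"
    "HOL-Library.Poly_Mapping"
    "HOL-Library.Extended_Real"
begin

text \<open>
  A monomial is represented by its exponent vector, of type \<^typ>\<open>nat \<Rightarrow>\<^sub>0 nat\<close>, and a polynomial by the
  finitely supported function sending each exponent vector to its coefficient. Multiplication of
  polynomials is the convolution product of \<^typ>\<open>(nat \<Rightarrow>\<^sub>0 nat) \<Rightarrow>\<^sub>0 'k\<close>. The variables of the ring in
  \<open>n\<close> variables are indexed by \<open>1, \<dots>, n\<close>; in particular the index \<open>0\<close> does not occur.
\<close>

definition poly_ring :: "nat \<Rightarrow> ((nat \<Rightarrow>\<^sub>0 nat) \<Rightarrow>\<^sub>0 'k::field) ring" where
  "poly_ring n =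
    \<lparr>carrier = {p. \<forall>w\<in>Poly_Mapping.keys p. Poly_Mapping.keys w \<subseteq> {1..n}},
     mult = (*), one = 1, zero = 0, add = (+)\<rparr>"

definition monomial :: "(nat \<Rightarrow>\<^sub>0 nat) \<Rightarrow> ((nat \<Rightarrow>\<^sub>0 nat) \<Rightarrow>\<^sub>0 'k::field)" where
  "monomial w = Poly_Mapping.single w 1"

definition var :: "nat \<Rightarrow> ((nat \<Rightarrow>\<^sub>0 nat) \<Rightarrow>\<^sub>0 'k::field)" where
  "var i = monomial (Poly_Mapping.single i 1)"

definition max_ideal :: "nat \<Rightarrow> ((nat \<Rightarrow>\<^sub>0 nat) \<Rightarrow>\<^sub>0 'k::field) set" where
  "max_ideal n = Idl\<^bsub>poly_ring n\<^esub> (var ` {1..n})"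

definition monomials_of_degree :: "nat \<Rightarrow> nat \<Rightarrow> (nat \<Rightarrow>\<^sub>0 nat) set" where
  "monomials_of_degree n d =
    {w. Poly_Mapping.keys w \<subseteq> {1..n} \<and> (\<Sum>i=1..n. Poly_Mapping.lookup w i) = d}"

text \<open>
  The library order on \<^typ>\<open>nat \<Rightarrow>\<^sub>0 nat\<close> compares two exponent vectors at the smallest index where
  they differ; it is the lexicographic order of monomials with \<open>x\<^sub>1 > x\<^sub>2 > \<dots> > x\<^sub>n\<close>.
\<close>

lemma monomial_less_iff:
  fixes v u :: "nat \<Rightarrow>\<^sub>0 nat"
  shows "v < u \<longleftrightarrow> (\<exists>i. Poly_Mapping.lookup v i < Poly_Mapping.lookup u i \<and>
    (\<forall>j<i. Poly_Mapping.lookup v j = Poly_Mapping.lookup u j))"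
  by (simp add: less_poly_mapping.rep_eq less_fun_def)

definition lexsegment :: "nat \<Rightarrow> nat \<Rightarrow> (nat \<Rightarrow>\<^sub>0 nat) \<Rightarrow> (nat \<Rightarrow>\<^sub>0 nat) \<Rightarrow> (nat \<Rightarrow>\<^sub>0 nat) set" where
  "lexsegment n d u v = {w \<in> monomials_of_degree n d. v \<le> w \<and> w \<le> u}"

definition lexsegment_ideal ::
    "nat \<Rightarrow> nat \<Rightarrow> (nat \<Rightarrow>\<^sub>0 nat) \<Rightarrow> (nat \<Rightarrow>\<^sub>0 nat) \<Rightarrow> ((nat \<Rightarrow>\<^sub>0 nat) \<Rightarrow>\<^sub>0 'k::field) set" where
  "lexsegment_ideal n d u v = Idl\<^bsub>poly_ring n\<^esub> (monomial ` lexsegment n d u v)"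

text \<open>
  The supremum of the lengths of chains of prime ideals. It is taken in \<^typ>\<open>ereal\<close>, so that the
  zero ring has dimension \<open>-\<infinity>\<close> and rings with arbitrarily long chains have dimension \<open>\<infinity>\<close>.
\<close>

definition krull_dim :: "('a, 'b) ring_scheme \<Rightarrow> ereal" where
  "krull_dim R = Sup {ereal (real m) |m.
    \<exists>P :: nat \<Rightarrow> 'a set. (\<forall>i\<le>m. primeideal (P i) R) \<and> (\<forall>i<m. P i \<subset> P (Suc i))}"

lemma cring_poly_ring: "cring (poly_ring n :: ((nat \<Rightarrow>\<^sub>0 nat) \<Rightarrow>\<^sub>0 'k::field) ring)"
proof -
  let ?C = "{p :: (nat \<Rightarrow>\<^sub>0 nat) \<Rightarrow>\<^sub>0 'k. \<forall>w\<in>Poly_Mapping.keys p. Poly_Mapping.keys w \<subseteq> {1..n}}"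
  have add: "p + q \<in> ?C" if "p \<in> ?C" "q \<in> ?C" for p q
    using that Poly_Mapping.keys_add[of p q] by blast
  have mult: "p * q \<in> ?C" if pq: "p \<in> ?C" "q \<in> ?C" for p q
  proof -
    have "Poly_Mapping.keys w \<subseteq> {1..n}" if "w \<in> Poly_Mapping.keys (p * q)" for w
    proof -
      obtain a b where ab: "w = a + b" "a \<in> Poly_Mapping.keys p" "b \<in> Poly_Mapping.keys q"
        using \<open>w \<in> Poly_Mapping.keys (p * q)\<close> Poly_Mapping.keys_mult[of p q] by blast
      have "Poly_Mapping.keys w \<subseteq> Poly_Mapping.keys a \<union> Poly_Mapping.keys b"
        unfolding ab(1) by (rule Poly_Mapping.keys_add)
      then show ?thesis
        using ab(2,3) pq by blast
    qed
    then show ?thesis by blast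
  qed
  have one: "1 \<in> ?C"
    by simp
  have uminus: "- p \<in> ?C" if "p \<in> ?C" for p
    using that by simp
  let ?R = "poly_ring n :: ((nat \<Rightarrow>\<^sub>0 nat) \<Rightarrow>\<^sub>0 'k) ring"
  have R: "carrier ?R = ?C" "mult ?R = (*)" "one ?R = 1" "zero ?R = 0" "add ?R = (+)"
    by (simp_all only: poly_ring_def partial_object.simps monoid.simps ring.simps)
  have zero: "0 \<in> ?C"
    by simp
  show ?thesis
  proof (rule cringI)
    show "abelian_group ?R"
    proof (rule abelian_groupI, unfold R)
      fix x :: "(nat \<Rightarrow>\<^sub>0 nat) \<Rightarrow>\<^sub>0 'k" assume "x \<in> ?C"
      then show "\<exists>y\<in>?C. y + x = 0"
        by (intro bexI[of _ "- x"] uminus left_minus)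
    qed (rule add zero add.assoc add.commute add_0; assumption?)+
    show "comm_monoid ?R"
      by (rule comm_monoidI, unfold R) (rule mult one mult.assoc mult.commute mult_1; assumption?)+
  qed (unfold R, rule distrib_right)
qed

end

theory Submission
  imports Defs
begin

text \<open>
  A prime ideal containing \<open>I\<close> contains, with a monomial, one of its variables. Since \<open>x\<^sub>i\<^sup>d\<close> lies in the
  lexsegment for \<open>2 \<le> i \<le> q\<close>, and \<open>x\<^sub>1 x\<^sub>n\<^bsup>d-1\<^esup>\<close> (or \<open>u\<close>, if \<open>q = 1\<close>) does for \<open>q < n\<close>, such a prime
  contains \<open>q\<close> variables, or \<open>n - 1\<close> of them if \<open>q = n\<close>. Conversely every monomial of the
  lexsegment involves one of \<open>x\<^sub>1, \<dots>, x\<^sub>q\<close>. For \<open>q = n\<close> every one involves one of \<open>x\<^sub>2, \<dots>, x\<^sub>n\<close>, as otherwise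
  \<open>x\<^sub>1\<^sup>d\<close> and \<open>x\<^sub>n\<^sup>d\<close> are its ends and \<open>I = \<mm>\<^sup>d\<close>. So \<open>I\<close> lies in the corresponding prime ideal
  generated by variables, from which a chain is obtained by adding one variable at a time.

  The upper bound rests on the fact that a strict chain of primes \<open>P\<^sub>0 \<subset> \<dots> \<subset> P\<^sub>m\<close> whose first
  member contains all but \<open>r\<close> of the variables satisfies \<open>m \<le> r\<close>. Otherwise choose
  \<open>y\<^sub>i \<in> P\<^bsub>i+1\<^esub> - P\<^sub>i\<close> in the remaining \<open>r\<close> variables. More than \<open>r\<close> such polynomials are
  algebraically dependent, and a nontrivial relation between them descends along the chain to a
  nonzero constant in some \<open>P\<^sub>i\<close>.
\<close>

section \<open>Arithmetic in the polynomial ring and its ideals\<close>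

lemma poly_ring_simps [simp]:
  "mult (poly_ring n) = (*)" "add (poly_ring n) = (+)" "zero (poly_ring n) = 0" "one (poly_ring n) = 1"
  by (simp_all add: poly_ring_def)

lemma mem_carrier_poly_ring:
  "p \<in> carrier (poly_ring n) \<longleftrightarrow> (\<forall>w\<in>Poly_Mapping.keys p. Poly_Mapping.keys w \<subseteq> {1..n})"
  by (simp add: poly_ring_def)

lemma keys_plus_nat: "Poly_Mapping.keys (a + w :: nat \<Rightarrow>\<^sub>0 nat) = Poly_Mapping.keys a \<union> Poly_Mapping.keys w"
  by (auto simp: in_keys_iff lookup_add)

lemma poly_mapping_eq_sum_single:
  "p = (\<Sum>w\<in>Poly_Mapping.keys p. Poly_Mapping.single w (Poly_Mapping.lookup p w))"
  by (rule poly_mapping_eqI)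
    (auto simp: lookup_sum lookup_single when_def sum.delta in_keys_iff)

text \<open>Scalars act as constant polynomials \<open>Poly_Mapping.single 0 c\<close>, so closure
  of an ideal under scaling becomes a case of closure under ring multiplication.\<close>

lemma single_eq_monomial: "Poly_Mapping.single w c = Poly_Mapping.single 0 c * monomial w"
  by (simp add: monomial_def mult_single)

lemma monomial_plus: "monomial (a + b) = monomial a * monomial b"
  by (simp add: monomial_def mult_single)

lemma zero_in_carrier [simp]: "0 \<in> carrier (poly_ring n)"
  and one_in_carrier [simp]: "1 \<in> carrier (poly_ring n)"
  by (simp_all add: mem_carrier_poly_ring)

lemma const_in_carrier [simp]: "Poly_Mapping.single 0 c \<in> carrier (poly_ring n)"
  by (simp add: mem_carrier_poly_ring)

lemma monomial_in_carrier [simp]: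
  "(monomial w :: (nat \<Rightarrow>\<^sub>0 nat) \<Rightarrow>\<^sub>0 'k::field) \<in> carrier (poly_ring n) \<longleftrightarrow> Poly_Mapping.keys w \<subseteq> {1..n}"
  by (simp add: mem_carrier_poly_ring monomial_def)

context
  fixes n :: nat and P :: "((nat \<Rightarrow>\<^sub>0 nat) \<Rightarrow>\<^sub>0 'k::field) set"
  assumes P: "ideal P (poly_ring n)"
begin

interpretation ideal P "poly_ring n" by (rule P)

lemma ideal_zero: "0 \<in> P"
  using additive_subgroup.zero_closed[OF additive_subgroup_axioms] by simp

lemma ideal_plus: "a \<in> P \<Longrightarrow> b \<in> P \<Longrightarrow> a + b \<in> P"
  using additive_subgroup.a_closed[OF additive_subgroup_axioms, of a b] by simp

lemma ideal_times: "a \<in> P \<Longrightarrow> r \<in> carrier (poly_ring n) \<Longrightarrow> r * a \<in> P"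
  using I_l_closed[of a r] by simp

lemma ideal_carrier: "a \<in> P \<Longrightarrow> a \<in> carrier (poly_ring n)"
  using a_subset by blast

lemma ideal_minus: assumes "a \<in> P" "b \<in> P" shows "a - b \<in> P"
proof -
  \<comment> \<open>Multiplying by the constant -1 gives the type's own negation and bypasses the
    additive inverse of the ring record.\<close>
  have "Poly_Mapping.single 0 (- 1) * b \<in> P"
    using assms by (intro ideal_times) auto
  then have "- b \<in> P"
    by (simp add: single_uminus)
  then show ?thesis
    using ideal_plus[OF assms(1), of "- b"] by simp
qed

lemma ideal_sum: "(\<And>x. x \<in> A \<Longrightarrow> f x \<in> P) \<Longrightarrow> sum f A \<in> P"
  by (induction A rule: infinite_finite_induct) (auto simp: ideal_zero ideal_plus)

text \<open>A polynomial is a combination of its monomials with constant coefficients. Inclusions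
  between ideals are thereby checked on monomials only.\<close>

lemma ideal_polyI: assumes "\<And>w. w \<in> Poly_Mapping.keys p \<Longrightarrow> monomial w \<in> P" shows "p \<in> P"
proof -
  have "(\<Sum>w\<in>Poly_Mapping.keys p. Poly_Mapping.single w (Poly_Mapping.lookup p w)) \<in> P"
    using assms by (intro ideal_sum) (subst single_eq_monomial, intro ideal_times, auto)
  then show ?thesis
    using poly_mapping_eq_sum_single[of p] by simp
qed

end

lemma carrier_plus: "a \<in> carrier (poly_ring n) \<Longrightarrow> b \<in> carrier (poly_ring n) \<Longrightarrow> a + b \<in> carrier (poly_ring n)"
  and carrier_times: "a \<in> carrier (poly_ring n) \<Longrightarrow> b \<in> carrier (poly_ring n) \<Longrightarrow> a * b \<in> carrier (poly_ring n)"
  and carrier_power: "a \<in> carrier (poly_ring n) \<Longrightarrow> a ^ k \<in> carrier (poly_ring n)"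
  for a :: "(nat \<Rightarrow>\<^sub>0 nat) \<Rightarrow>\<^sub>0 'k::field"
proof -
  interpret cring "poly_ring n :: ((nat \<Rightarrow>\<^sub>0 nat) \<Rightarrow>\<^sub>0 'k) ring" by (rule cring_poly_ring)
  show "a \<in> carrier (poly_ring n) \<Longrightarrow> b \<in> carrier (poly_ring n) \<Longrightarrow> a + b \<in> carrier (poly_ring n)"
    using a_closed[of a b] by simp
  show times: "b \<in> carrier (poly_ring n) \<Longrightarrow> a \<in> carrier (poly_ring n) \<Longrightarrow> b * a \<in> carrier (poly_ring n)"
    for a b :: "(nat \<Rightarrow>\<^sub>0 nat) \<Rightarrow>\<^sub>0 'k"
    using m_closed[of b a] by simp
  show "a \<in> carrier (poly_ring n) \<Longrightarrow> a ^ k \<in> carrier (poly_ring n)"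
    by (induction k) (auto intro: times)
qed

lemma carrier_sum:
  "(\<And>x. x \<in> A \<Longrightarrow> f x \<in> carrier (poly_ring n)) \<Longrightarrow> sum f A \<in> carrier (poly_ring n)"
  by (induction A rule: infinite_finite_induct) (auto simp: carrier_plus)

lemma prime_times:
  assumes "primeideal P (poly_ring n)" "a * b \<in> P" "a \<in> carrier (poly_ring n)" "b \<in> carrier (poly_ring n)"
  shows "a \<in> P \<or> b \<in> P"
  using primeideal.I_prime[OF assms(1), of a b] assms by simp

lemma prime_one: assumes "primeideal P (poly_ring n)" shows "1 \<notin> P"
proof -
  interpret primeideal P "poly_ring n" by (rule assms)
  show ?thesis
    using one_imp_carrier I_notcarr by auto
qed

lemma prime_power:
  assumes "primeideal P (poly_ring n)" "a ^ k \<in> P" "a \<in> carrier (poly_ring n)"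
  shows "a \<in> P"
  using assms(2)
proof (induction k)
  case 0
  then show ?case using prime_one[OF assms(1)] by simp
next
  case (Suc k)
  then show ?case using prime_times[OF assms(1), of a "a ^ k"] assms(3) carrier_power by auto
qed

text \<open>A nonzero constant is a unit. This ends the descent of a relation along a chain of
  primes.\<close>

lemma prime_const:
  assumes "primeideal P (poly_ring n)" "Poly_Mapping.single 0 c \<in> P"
  shows "c = 0"
proof (rule ccontr)
  assume "c \<noteq> 0"
  then have "Poly_Mapping.single 0 (inverse c) * Poly_Mapping.single 0 c = (1 :: (nat \<Rightarrow>\<^sub>0 nat) \<Rightarrow>\<^sub>0 'a)"
    by (simp add: mult_single)
  then show False
    using ideal_times[OF primeideal.axioms(1)[OF assms(1)] assms(2), of "Poly_Mapping.single 0 (inverse c)"]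
      prime_one[OF assms(1)] by simp
qed

section \<open>Variables and monomials in prime ideals\<close>

text \<open>Subtraction of exponents is truncated; it is exact here because the exponent at
  \<open>i\<close> is positive.\<close>

lemma monomial_split:
  fixes w :: "nat \<Rightarrow>\<^sub>0 nat"
  assumes "i \<in> Poly_Mapping.keys w"
  shows "w = Poly_Mapping.single i 1 + (w - Poly_Mapping.single i 1)"
  using assms by (intro poly_mapping_eqI) (auto simp: lookup_add lookup_minus lookup_single when_def in_keys_iff)

lemma monomial_eq_var_times:
  assumes "i \<in> Poly_Mapping.keys w"
  shows "monomial w = var i * monomial (w - Poly_Mapping.single i 1)"
  using monomial_split[OF assms] by (metis monomial_plus var_def)

lemma keys_minus_subset: "Poly_Mapping.keys (w - a :: nat \<Rightarrow>\<^sub>0 nat) \<subseteq> Poly_Mapping.keys w"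
  by (auto simp: in_keys_iff lookup_minus)

lemma monomial_in_ideal:
  assumes "ideal P (poly_ring n)" "Poly_Mapping.keys w \<subseteq> {1..n}" "i \<in> Poly_Mapping.keys w" "var i \<in> P"
  shows "monomial w \<in> P"
  using ideal_times[OF assms(1,4), of "monomial (w - Poly_Mapping.single i 1)"] assms(2) keys_minus_subset[of w]
  by (simp add: monomial_eq_var_times[OF assms(3)] mult.commute) blast

definition total_degree :: "nat \<Rightarrow> (nat \<Rightarrow>\<^sub>0 nat) \<Rightarrow> nat" where
  "total_degree n w = (\<Sum>i=1..n. Poly_Mapping.lookup w i)"

lemma total_degree_zero [simp]: "total_degree n 0 = 0"
  by (simp add: total_degree_def)

lemma total_degree_add: "total_degree n (a + b) = total_degree n a + total_degree n b"
  by (simp add: total_degree_def lookup_add sum.distrib)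

lemma total_degree_single:
  "total_degree n (Poly_Mapping.single i k) = (if i \<in> {1..n} then k else 0)"
  by (simp add: total_degree_def lookup_single when_def sum.delta)

text \<open>Splitting off one variable lowers the total degree, and primality puts either that
  variable or the cofactor into \<open>P\<close>.\<close>

lemma prime_monomial:
  assumes "primeideal P (poly_ring n)" "Poly_Mapping.keys w \<subseteq> {1..n}" "monomial w \<in> P"
  shows "\<exists>i\<in>Poly_Mapping.keys w. var i \<in> P"
  using assms(2,3)
proof (induction "total_degree n w" arbitrary: w rule: less_induct)
  case less
  \<comment> \<open>The monomial with exponent vector 0 is 1, which no prime contains.\<close>
  have "w \<noteq> 0"
    using less.prems prime_one[OF assms(1)] by (auto simp: monomial_def)
  then obtain i where i: "i \<in> Poly_Mapping.keys w"
    by (metis ex_in_conv keys_eq_empty)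
  define w' where "w' = w - Poly_Mapping.single i 1"
  have w: "w = Poly_Mapping.single i 1 + w'"
    unfolding w'_def by (rule monomial_split[OF i])
  have sub: "Poly_Mapping.keys w' \<subseteq> Poly_Mapping.keys w"
    unfolding w'_def by (rule keys_minus_subset)
  have "i \<in> {1..n}"
    using i less.prems by blast
  then have deg: "total_degree n w' < total_degree n w"
    using total_degree_add[of n "Poly_Mapping.single i 1" w'] total_degree_single[of n i 1] w by simp
  have "var i * monomial w' \<in> P"
    unfolding w'_def monomial_eq_var_times[OF i, symmetric] by (rule less.prems)
  then have "var i \<in> P \<or> monomial w' \<in> P"
    using i sub less.prems by (intro prime_times[OF assms(1)]) (auto simp: var_def)
  then show ?case
    using less.hyps[OF deg] sub less.prems i by blast
qed

section \<open>Monomial ideals and primes generated by variables\<close>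

text \<open>For \<open>S\<close> closed under adding arbitrary exponent vectors this is a monomial
  ideal. Ideals of variables and powers of the maximal ideal all take this form, so that membership
  is read off the exponents.\<close>

definition monomial_span :: "nat \<Rightarrow> (nat \<Rightarrow>\<^sub>0 nat) set \<Rightarrow> ((nat \<Rightarrow>\<^sub>0 nat) \<Rightarrow>\<^sub>0 'k::field) set" where
  "monomial_span n S = {p \<in> carrier (poly_ring n). Poly_Mapping.keys p \<subseteq> S}"

lemma ideal_monomial_span:
  assumes up: "\<And>a w. w \<in> S \<Longrightarrow> a + w \<in> S"
  shows "ideal (monomial_span n S :: ((nat \<Rightarrow>\<^sub>0 nat) \<Rightarrow>\<^sub>0 'k::field) set) (poly_ring n)"
proof -
  let ?R = "poly_ring n :: ((nat \<Rightarrow>\<^sub>0 nat) \<Rightarrow>\<^sub>0 'k) ring"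
  let ?M = "monomial_span n S :: ((nat \<Rightarrow>\<^sub>0 nat) \<Rightarrow>\<^sub>0 'k) set"
  interpret cring ?R by (rule cring_poly_ring)
  have times: "r * a \<in> ?M" if "a \<in> ?M" "r \<in> carrier ?R" for a r
    using that keys_mult[of r a] up carrier_times[of r n a] unfolding monomial_span_def by blast
  have plus: "a + b \<in> ?M" if "a \<in> ?M" "b \<in> ?M" for a b
    using that keys_add[of a b] carrier_plus[of a n b] unfolding monomial_span_def by blast
  show ?thesis
  proof (rule idealI)
    show "subgroup ?M (add_monoid ?R)"
    proof (rule add.subgroupI)
      show "?M \<subseteq> carrier ?R" unfolding monomial_span_def by blast
      have "0 \<in> ?M" unfolding monomial_span_def by (simp add: mem_carrier_poly_ring)
      then show "?M \<noteq> {}" by blast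
    next
      fix a assume a: "a \<in> ?M"
      then have "a \<in> carrier ?R" unfolding monomial_span_def by blast
      moreover have "- a \<in> carrier ?R"
        using calculation by (simp add: mem_carrier_poly_ring)
      \<comment> \<open>The inverse in the ring record has to be identified with the negation of the
        type.\<close>
      ultimately have "\<ominus>\<^bsub>?R\<^esub> a = - a"
        by (intro minus_equality) auto
      then show "\<ominus>\<^bsub>?R\<^esub> a \<in> ?M"
        using a by (simp add: monomial_span_def mem_carrier_poly_ring)
    next
      fix a b assume "a \<in> ?M" "b \<in> ?M"
      then show "a \<oplus>\<^bsub>?R\<^esub> b \<in> ?M" using plus by simp
    qed
  next
    fix a x assume "a \<in> ?M" "x \<in> carrier ?R"
    then show "x \<otimes>\<^bsub>?R\<^esub> a \<in> ?M" "a \<otimes>\<^bsub>?R\<^esub> x \<in> ?M"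
      using times[of a x] by (auto simp: mult.commute)
  qed (rule ring_axioms)
qed

text \<open>The ideal generated by the variables with index in \<open>V\<close> (for
  \<open>V\<close> within \<open>{1..n}\<close>), described through supports instead of
  generators.\<close>

abbreviation var_ideal :: "nat \<Rightarrow> nat set \<Rightarrow> ((nat \<Rightarrow>\<^sub>0 nat) \<Rightarrow>\<^sub>0 'k::field) set" where
  "var_ideal n V \<equiv> monomial_span n {w. Poly_Mapping.keys w \<inter> V \<noteq> {}}"

lemma ideal_var_ideal: "ideal (var_ideal n V) (poly_ring n)"
  by (rule ideal_monomial_span) (auto simp: keys_plus_nat)

text \<open>Sorting the terms of \<open>p\<close> by whether they involve \<open>V\<close>. The part
  \<open>r\<close> is the normal form of \<open>p\<close> modulo the variables in
  \<open>V\<close>.\<close>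

lemma split_by_variables:
  fixes p :: "(nat \<Rightarrow>\<^sub>0 nat) \<Rightarrow>\<^sub>0 'k::field"
  assumes "p \<in> carrier (poly_ring n)"
  obtains r s where "p = r + s" "r \<in> carrier (poly_ring n)" "s \<in> var_ideal n V"
    "\<forall>w\<in>Poly_Mapping.keys r. Poly_Mapping.keys w \<inter> V = {}"
proof
  let ?B = "{w \<in> Poly_Mapping.keys p. Poly_Mapping.keys w \<inter> V = {}}"
  let ?f = "\<lambda>w. Poly_Mapping.single w (Poly_Mapping.lookup p w)"
  have sub: "Poly_Mapping.keys (sum ?f B) \<subseteq> B" if "B \<subseteq> Poly_Mapping.keys p" for B
    using keys_sum[of ?f B] by (force split: if_splits)
  have "p = sum ?f (Poly_Mapping.keys p)"
    by (rule poly_mapping_eq_sum_single)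
  also have "\<dots> = sum ?f ?B + sum ?f (Poly_Mapping.keys p - ?B)"
    by (subst sum.subset_diff[of ?B]) (auto simp: add.commute)
  finally show "p = sum ?f ?B + sum ?f (Poly_Mapping.keys p - ?B)" .
  show "sum ?f ?B \<in> carrier (poly_ring n)" "\<forall>w\<in>Poly_Mapping.keys (sum ?f ?B). Poly_Mapping.keys w \<inter> V = {}"
    using sub[of ?B] assms unfolding mem_carrier_poly_ring by blast+
  show "sum ?f (Poly_Mapping.keys p - ?B) \<in> var_ideal n V"
    using sub[of "Poly_Mapping.keys p - ?B"] assms unfolding monomial_span_def mem_carrier_poly_ring by blast
qed

text \<open>Modulo the variables in \<open>V\<close> the normal forms multiply as polynomials in the
  other variables, and these have no zero divisors.\<close>

lemma prime_var_ideal: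
  "primeideal (var_ideal n V :: ((nat \<Rightarrow>\<^sub>0 nat) \<Rightarrow>\<^sub>0 'k::field) set) (poly_ring n)"
proof (rule primeidealI)
  let ?R = "poly_ring n :: ((nat \<Rightarrow>\<^sub>0 nat) \<Rightarrow>\<^sub>0 'k) ring"
  let ?J = "var_ideal n V :: ((nat \<Rightarrow>\<^sub>0 nat) \<Rightarrow>\<^sub>0 'k) set"
  show J: "ideal ?J ?R" by (rule ideal_var_ideal)
  show "cring ?R" by (rule cring_poly_ring)
  have "1 \<notin> ?J" "1 \<in> carrier ?R" by (simp_all add: monomial_span_def mem_carrier_poly_ring)
  then show "carrier ?R \<noteq> ?J" by blast
  fix a b assume ab: "a \<in> carrier ?R" "b \<in> carrier ?R" "a \<otimes>\<^bsub>?R\<^esub> b \<in> ?J"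
  obtain r s where a: "a = r + s" "r \<in> carrier ?R" "s \<in> ?J" "\<forall>w\<in>Poly_Mapping.keys r. Poly_Mapping.keys w \<inter> V = {}"
    using split_by_variables[OF ab(1)] by blast
  obtain r' s' where b: "b = r' + s'" "r' \<in> carrier ?R" "s' \<in> ?J" "\<forall>w\<in>Poly_Mapping.keys r'. Poly_Mapping.keys w \<inter> V = {}"
    using split_by_variables[OF ab(2)] by blast
  have "r * r' = a * b - (b * s + r * s')"
    by (simp add: a(1) b(1) algebra_simps)
  also have "\<dots> \<in> ?J"
    using ab(3) ideal_times[OF J a(3) ab(2)] ideal_times[OF J b(3) a(2)]
    by (simp add: ideal_minus[OF J] ideal_plus[OF J])
  finally have "Poly_Mapping.keys (r * r') \<subseteq> {w. Poly_Mapping.keys w \<inter> V \<noteq> {}}"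
    unfolding monomial_span_def by blast
  \<comment> \<open>A product of two normal forms is again free of \<open>V\<close>; lying in the
    ideal as well, it has no terms left.\<close>
  moreover have "Poly_Mapping.keys w \<inter> V = {}" if w: "w \<in> Poly_Mapping.keys (r * r')" for w
  proof -
    obtain x y where "w = x + y" "x \<in> Poly_Mapping.keys r" "y \<in> Poly_Mapping.keys r'"
      using w keys_mult[of r r'] by blast
    then show ?thesis
      using a(4) b(4) by (auto simp: keys_plus_nat)
  qed
  ultimately have "Poly_Mapping.keys (r * r') = {}"
    by blast
  then have "r * r' = 0" by simp
  then consider "r = 0" | "r' = 0" by auto
  then show "a \<in> ?J \<or> b \<in> ?J"
    using a(1,3) b(1,3) by cases simp_all
qed

section \<open>Algebraic dependence and chains of prime ideals\<close>

text \<open>Recursion runs over the polynomials only and reads the exponents by \<open>hd\<close>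
  and \<open>tl\<close>; the intended product arises when both lists have equal length.\<close>

primrec power_product :: "'a::comm_monoid_mult list \<Rightarrow> nat list \<Rightarrow> 'a" where
  "power_product [] \<alpha> = 1"
| "power_product (y # ys) \<alpha> = y ^ hd \<alpha> * power_product ys (tl \<alpha>)"

lemma power_product_in_carrier:
  "set ys \<subseteq> carrier (poly_ring n) \<Longrightarrow> power_product ys \<alpha> \<in> carrier (poly_ring n)"
  by (induction ys arbitrary: \<alpha>)
    (auto simp: carrier_times carrier_power)

text \<open>Each exponent is bounded separately, not the total degree. The set is then a box, which
  is easy to count.\<close>

definition bounded_monomials :: "nat set \<Rightarrow> nat \<Rightarrow> (nat \<Rightarrow>\<^sub>0 nat) set" where
  "bounded_monomials W M = {w. Poly_Mapping.keys w \<subseteq> W \<and> (\<forall>i. Poly_Mapping.lookup w i \<le> M)}"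

lemma keys_mult_bounded:
  assumes "Poly_Mapping.keys p \<subseteq> bounded_monomials W M" "Poly_Mapping.keys q \<subseteq> bounded_monomials W M'"
  shows "Poly_Mapping.keys (p * q) \<subseteq> bounded_monomials W (M + M')"
proof
  fix w assume "w \<in> Poly_Mapping.keys (p * q)"
  then obtain a b where "w = a + b" "a \<in> Poly_Mapping.keys p" "b \<in> Poly_Mapping.keys q"
    using keys_mult[of p q] by blast
  moreover have "a \<in> bounded_monomials W M" "b \<in> bounded_monomials W M'"
    using calculation assms by blast+
  ultimately show "w \<in> bounded_monomials W (M + M')"
    by (auto simp: bounded_monomials_def keys_plus_nat lookup_add add_mono)
qed

lemma bounded_monomials_mono: "M \<le> M' \<Longrightarrow> bounded_monomials W M \<subseteq> bounded_monomials W M'"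
  unfolding bounded_monomials_def using le_trans by blast

lemma keys_power_bounded:
  "Poly_Mapping.keys p \<subseteq> bounded_monomials W M \<Longrightarrow> Poly_Mapping.keys (p ^ k) \<subseteq> bounded_monomials W (k * M)"
proof (induction k)
  case 0
  then show ?case by (auto simp: bounded_monomials_def)
next
  case (Suc k)
  then show ?case using keys_mult_bounded[of p W M "p ^ k" "k * M"] by simp
qed

text \<open>Every factor is a power with exponent below \<open>N\<close> of a polynomial with
  exponents at most \<open>D\<close>, so it adds at most \<open>N * D\<close> to the bound.\<close>

lemma keys_power_product_bounded:
  assumes "\<forall>y\<in>set ys. Poly_Mapping.keys y \<subseteq> bounded_monomials W D" "set \<alpha> \<subseteq> {..<N}" "length \<alpha> = length ys"
  shows "Poly_Mapping.keys (power_product ys \<alpha>) \<subseteq> bounded_monomials W (length ys * (N * D))"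
  using assms
proof (induction ys arbitrary: \<alpha>)
  case Nil
  then show ?case by (auto simp: bounded_monomials_def)
next
  case (Cons y ys)
  then obtain a \<beta> where \<alpha>: "\<alpha> = a # \<beta>"
    by (cases \<alpha>) auto
  have "Poly_Mapping.keys (y ^ a) \<subseteq> bounded_monomials W (a * D)"
    using Cons.prems by (intro keys_power_bounded) auto
  also have "\<dots> \<subseteq> bounded_monomials W (N * D)"
    using Cons.prems \<alpha> by (intro bounded_monomials_mono) auto
  finally show ?case
    using keys_mult_bounded[OF _ Cons.IH[of \<beta>], of "y ^ a" "N * D"] Cons.prems \<alpha> by auto
qed

text \<open>Exponent vectors in the box vanish off \<open>W\<close>, so restriction to
  \<open>W\<close> embeds them into the functions from \<open>W\<close> to
  \<open>{..M}\<close>.\<close>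

lemma card_bounded_monomials:
  assumes "finite W"
  shows "finite (bounded_monomials W M)" "card (bounded_monomials W M) \<le> (M + 1) ^ card W"
proof -
  let ?f = "\<lambda>w :: nat \<Rightarrow>\<^sub>0 nat. restrict (Poly_Mapping.lookup w) W"
  have inj: "inj_on ?f (bounded_monomials W M)"
  proof (rule inj_onI)
    fix w w' assume w: "w \<in> bounded_monomials W M" "w' \<in> bounded_monomials W M" "?f w = ?f w'"
    show "w = w'"
    proof (rule poly_mapping_eqI)
      fix i
      show "Poly_Mapping.lookup w i = Poly_Mapping.lookup w' i"
      proof (cases "i \<in> W")
        case True
        then show ?thesis using fun_cong[OF w(3), of i] by simp
      next
        case False
        then have "i \<notin> Poly_Mapping.keys w" "i \<notin> Poly_Mapping.keys w'"
          using w(1,2) unfolding bounded_monomials_def by blast+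
        then show ?thesis by (simp add: in_keys_iff)
      qed
    qed
  qed
  have sub: "?f ` bounded_monomials W M \<subseteq> W \<rightarrow>\<^sub>E {..M}"
    by (auto simp: bounded_monomials_def)
  have fin: "finite (W \<rightarrow>\<^sub>E {..M})"
    using assms by (intro finite_PiE) auto
  show "finite (bounded_monomials W M)"
    using inj_on_finite[OF inj sub fin] .
  show "card (bounded_monomials W M) \<le> (M + 1) ^ card W"
    using card_inj_on_le[OF inj sub fin] assms by (simp add: card_PiE)
qed

text \<open>Only finitely many positive exponents occur in the list; \<open>D\<close> bounds them
  all.\<close>

lemma bounded_monomials_exists:
  fixes ys :: "((nat \<Rightarrow>\<^sub>0 nat) \<Rightarrow>\<^sub>0 'k::zero) list"
  assumes "\<forall>y\<in>set ys. \<forall>w\<in>Poly_Mapping.keys y. Poly_Mapping.keys w \<subseteq> W"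
  obtains D where "\<forall>y\<in>set ys. Poly_Mapping.keys y \<subseteq> bounded_monomials W D"
proof -
  let ?E = "\<Union>y\<in>set ys. \<Union>w\<in>Poly_Mapping.keys y. Poly_Mapping.lookup w ` Poly_Mapping.keys w"
  have "finite ?E" by auto
  then obtain D where D: "\<forall>k\<in>?E. k \<le> D"
    unfolding finite_nat_set_iff_bounded_le by blast
  have le: "Poly_Mapping.lookup w i \<le> D" if "y \<in> set ys" "w \<in> Poly_Mapping.keys y" for y w i
  proof (cases "i \<in> Poly_Mapping.keys w")
    case True
    then show ?thesis using D that by blast
  qed (simp add: in_keys_iff)
  show thesis
  proof (rule that[of D], intro ballI subsetI)
    fix y w assume "y \<in> set ys" "w \<in> Poly_Mapping.keys y"
    then show "w \<in> bounded_monomials W D"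
      using assms le unfolding bounded_monomials_def by blast
  qed
qed

text \<open>The products \<open>y\<^sup>\<alpha>\<close> with all exponents below \<open>N\<close> number at least \<open>N ^ (card W + 1)\<close>, but lie in a
  space of dimension \<open>O(N ^ card W)\<close>.\<close>

lemma algebraic_dependence:
  fixes ys :: "((nat \<Rightarrow>\<^sub>0 nat) \<Rightarrow>\<^sub>0 'k::field) list"
  assumes W: "finite W" "card W < length ys" and ys: "\<forall>y\<in>set ys. \<forall>w\<in>Poly_Mapping.keys y. Poly_Mapping.keys w \<subseteq> W"
  obtains A c where "finite A" "A \<noteq> {}" "\<forall>\<alpha>\<in>A. length \<alpha> = length ys \<and> c \<alpha> \<noteq> 0"
    "(\<Sum>\<alpha>\<in>A. Poly_Mapping.single 0 (c \<alpha>) * power_product ys \<alpha>) = 0"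
proof -
  interpret vector_space "\<lambda>(c::'k) (p::(nat \<Rightarrow>\<^sub>0 nat) \<Rightarrow>\<^sub>0 'k). Poly_Mapping.single 0 c * p"
    by unfold_locales (simp_all add: algebra_simps single_add mult_single flip: mult.assoc)
  let ?l = "length ys" and ?r = "card W"
  obtain D where D: "\<forall>y\<in>set ys. Poly_Mapping.keys y \<subseteq> bounded_monomials W D"
    using bounded_monomials_exists[OF ys] by blast
  \<comment> \<open>With this \<open>N\<close>, \<open>M + 1\<close> is at most
    \<open>(?l * D + 1) * N\<close>, so the box has at most \<open>(N - 1) * N ^ ?r\<close>
    elements. The summand 1 makes this less than \<open>N ^ Suc ?r\<close>.\<close>
  define N where "N = (?l * D + 1) ^ ?r + 1"
  define M where "M = ?l * (N * D)"
  let ?A = "{\<alpha>. set \<alpha> \<subseteq> {..<N} \<and> length \<alpha> = ?l}"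
  let ?B = "monomial ` bounded_monomials W M :: ((nat \<Rightarrow>\<^sub>0 nat) \<Rightarrow>\<^sub>0 'k) set"
  have "M + 1 \<le> (?l * D + 1) * N"
    by (simp add: M_def N_def algebra_simps)
  then have "(M + 1) ^ ?r \<le> ((?l * D + 1) * N) ^ ?r"
    by (rule power_mono) simp
  also have "\<dots> = (?l * D + 1) ^ ?r * N ^ ?r"
    by (rule power_mult_distrib)
  also have "\<dots> < N * N ^ ?r"
    by (simp add: N_def)
  also have "\<dots> = N ^ Suc ?r"
    by simp
  also have "\<dots> \<le> N ^ ?l"
    using W by (intro power_increasing) (auto simp: N_def)
  finally have less: "(M + 1) ^ ?r < N ^ ?l" .
  have A: "finite ?A" "card ?A = N ^ ?l"
    by (simp_all add: finite_lists_length_eq card_lists_length_eq)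
  have B: "finite ?B" "card ?B < card ?A"
    using card_bounded_monomials[OF W(1), of M] card_image_le[of "bounded_monomials W M" "monomial :: _ \<Rightarrow> (nat \<Rightarrow>\<^sub>0 nat) \<Rightarrow>\<^sub>0 'k"]
      less A by auto
  have "p \<in> span ?B" if "Poly_Mapping.keys p \<subseteq> bounded_monomials W M" for p
  proof -
    have "(\<Sum>w\<in>Poly_Mapping.keys p. Poly_Mapping.single 0 (Poly_Mapping.lookup p w) * monomial w) \<in> span ?B"
      using that by (intro span_sum span_scale span_base) auto
    then show ?thesis
      using poly_mapping_eq_sum_single[of p] by (simp flip: single_eq_monomial)
  qed
  then have span: "power_product ys ` ?A \<subseteq> span ?B"
    using keys_power_product_bounded[OF D] by (auto simp: M_def)
  show thesis
  \<comment> \<open>Linear dependence concerns a set of vectors, while the relation is indexed by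
    exponent lists. If two lists give the same product, their difference is already a
    relation.\<close>
  proof (cases "inj_on (power_product ys) ?A")
    case True
    then have "dependent (power_product ys ` ?A)"
      using independent_span_bound[OF B(1) _ span] B(2) card_image[OF True] by auto
    then obtain u where u: "\<exists>v\<in>power_product ys ` ?A. u v \<noteq> 0"
        "(\<Sum>v\<in>power_product ys ` ?A. Poly_Mapping.single 0 (u v) * v) = 0"
      using A(1) dependent_finite[of "power_product ys ` ?A"] by auto
    \<comment> \<open>Only nonzero coefficients are kept, as the descent needs every term to be
      genuine.\<close>
    let ?A' = "{\<alpha> \<in> ?A. u (power_product ys \<alpha>) \<noteq> 0}"
    have "(\<Sum>\<alpha>\<in>?A'. Poly_Mapping.single 0 (u (power_product ys \<alpha>)) * power_product ys \<alpha>) =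
        (\<Sum>\<alpha>\<in>?A. Poly_Mapping.single 0 (u (power_product ys \<alpha>)) * power_product ys \<alpha>)"
      using A(1) by (intro sum.mono_neutral_left) auto
    also have "\<dots> = 0"
      using u(2) by (simp add: sum.reindex[OF True])
    finally show thesis
      using u(1) finite_subset[OF _ A(1), of ?A'] by (intro that[of ?A' "\<lambda>\<alpha>. u (power_product ys \<alpha>)"]) auto
  next
    case False
    then obtain \<alpha> \<beta> where "\<alpha> \<in> ?A" "\<beta> \<in> ?A" "\<alpha> \<noteq> \<beta>" "power_product ys \<alpha> = power_product ys \<beta>"
      unfolding inj_on_def by blast
    then show thesis
      by (intro that[of "{\<alpha>, \<beta>}" "\<lambda>\<gamma>. if \<gamma> = \<alpha> then 1 else - 1"]) (auto simp: single_uminus)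
  qed
qed

text \<open>Dividing a relation by the lowest power of the first element and reducing modulo that element
  leaves a nonzero relation between the remaining ones, one step higher in the chain.\<close>

lemma no_relation_along_chain:
  assumes "\<forall>i\<le>length ys. primeideal (P i) (poly_ring n)"
    and "\<forall>i<length ys. P i \<subset> P (Suc i)"
    and "\<forall>i<length ys. ys ! i \<in> P (Suc i) \<and> ys ! i \<notin> P i"
    and "finite A" "A \<noteq> {}" "\<forall>\<alpha>\<in>A. length \<alpha> = length ys \<and> c \<alpha> \<noteq> 0"
  shows "(\<Sum>\<alpha>\<in>A. Poly_Mapping.single 0 (c \<alpha>) * power_product ys \<alpha>) \<notin> P 0"
  using assms
proof (induction ys arbitrary: P A c)
  case Nil
  \<comment> \<open>Without polynomials the relation is the single constant
    \<open>c []\<close>.\<close>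
  then have "A = {[]}" by auto
  then show ?case
    using Nil prime_const[of "P 0" n "c []"] by auto
next
  case (Cons y ys)
  \<comment> \<open>By minimality of \<open>a0\<close> the truncated differences
    \<open>hd \<alpha> - a0\<close> are exact; \<open>A1\<close> collects the terms from which
    \<open>y\<close> disappears after division.\<close>
  define a0 where "a0 = Min (hd ` A)"
  define A1 where "A1 = {\<alpha> \<in> A. hd \<alpha> = a0}"
  define T where "T \<alpha> = Poly_Mapping.single 0 (c \<alpha>) * (y ^ (hd \<alpha> - a0) * power_product ys (tl \<alpha>))" for \<alpha>
  have prime: "primeideal (P 0) (poly_ring n)" "primeideal (P 1) (poly_ring n)"
    using Cons.prems(1) by auto
  note ideal = prime[THEN primeideal.axioms(1)]
  have y: "y \<in> P 1" "y \<notin> P 0" and P01: "P 0 \<subseteq> P 1"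
    using Cons.prems(2,3) by force+
  have le: "a0 \<le> hd \<alpha>" if "\<alpha> \<in> A" for \<alpha>
    using that Cons.prems(4) by (simp add: a0_def)
  have "(y # ys) ! i \<in> carrier (poly_ring n)" if "i < length (y # ys)" for i
    using ideal_carrier[of "P (Suc i)" n] primeideal.axioms(1) Cons.prems(1,3) that by (meson Suc_leI)
  then have "set (y # ys) \<subseteq> carrier (poly_ring n)"
    by (metis in_set_conv_nth subsetI)
  then have carr: "y \<in> carrier (poly_ring n)" "set ys \<subseteq> carrier (poly_ring n)"
    by auto
  have T: "T \<alpha> \<in> carrier (poly_ring n)" for \<alpha>
    unfolding T_def using carr by (intro carrier_times const_in_carrier carrier_power power_product_in_carrier)
  have factor: "(\<Sum>\<alpha>\<in>A. Poly_Mapping.single 0 (c \<alpha>) * power_product (y # ys) \<alpha>) = y ^ a0 * sum T A"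
    unfolding sum_distrib_left
  proof (rule sum.cong[OF refl])
    fix \<alpha> assume "\<alpha> \<in> A"
    then have "y ^ hd \<alpha> = y ^ a0 * y ^ (hd \<alpha> - a0)"
      using le by (simp flip: power_add)
    then show "Poly_Mapping.single 0 (c \<alpha>) * power_product (y # ys) \<alpha> = y ^ a0 * T \<alpha>"
      by (simp add: T_def ac_simps)
  qed
  \<comment> \<open>All lists in \<open>A1\<close> share the head \<open>a0\<close>, so dropping it
    merges no two terms and cancels no coefficient.\<close>
  have inj: "inj_on tl A1"
  proof (rule inj_onI)
    fix \<alpha> \<beta> assume "\<alpha> \<in> A1" "\<beta> \<in> A1" "tl \<alpha> = tl \<beta>"
    moreover have "\<alpha> \<noteq> []" "\<beta> \<noteq> []"
      using calculation Cons.prems(6) unfolding A1_def by auto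
    ultimately show "\<alpha> = \<beta>"
      unfolding A1_def by (metis (mono_tags, lifting) list.expand mem_Collect_eq)
  qed
  have "a0 \<in> hd ` A"
    unfolding a0_def using Cons.prems(4,5) by (intro Min_in) auto
  then have "A1 \<noteq> {}" unfolding A1_def by auto
  have cons: "\<alpha> = a0 # tl \<alpha>" "length (tl \<alpha>) = length ys" "c \<alpha> \<noteq> 0" if "\<alpha> \<in> A1" for \<alpha>
    using that Cons.prems(6) by (auto simp: A1_def neq_Nil_conv length_Suc_conv)
  have "sum T A1 = (\<Sum>\<beta>\<in>tl ` A1. Poly_Mapping.single 0 (c (a0 # \<beta>)) * power_product ys \<beta>)"
    unfolding sum.reindex[OF inj]
  proof (rule sum.cong[OF refl])
    fix \<alpha> assume \<alpha>: "\<alpha> \<in> A1"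
    then have "hd \<alpha> = a0" by (simp add: A1_def)
    moreover have "a0 # tl \<alpha> = \<alpha>" using cons(1)[OF \<alpha>] by (rule sym)
    ultimately show "T \<alpha> = ((\<lambda>\<beta>. Poly_Mapping.single 0 (c (a0 # \<beta>)) * power_product ys \<beta>) \<circ> tl) \<alpha>"
      by (simp add: T_def)
  qed
  \<comment> \<open>The induction hypothesis applies to the chain shifted by one, which starts at
    \<open>P (Suc 0)\<close>.\<close>
  also have "\<dots> \<notin> P (Suc 0)"
  proof (rule Cons.IH)
    show "finite (tl ` A1)" "tl ` A1 \<noteq> {}"
      using Cons.prems(4) \<open>A1 \<noteq> {}\<close> by (simp_all add: A1_def)
    show "\<forall>\<beta>\<in>tl ` A1. length \<beta> = length ys \<and> c (a0 # \<beta>) \<noteq> 0"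
    proof clarify
      fix \<alpha> assume \<alpha>: "\<alpha> \<in> A1"
      show "length (tl \<alpha>) = length ys \<and> c (a0 # tl \<alpha>) \<noteq> 0"
        using cons(2,3)[OF \<alpha>] cons(1)[OF \<alpha>, symmetric] by simp
    qed
    show "\<forall>i\<le>length ys. primeideal (P (Suc i)) (poly_ring n)" "\<forall>i<length ys. P (Suc i) \<subset> P (Suc (Suc i))"
      using Cons.prems(1,2) by simp_all
    show "\<forall>i<length ys. ys ! i \<in> P (Suc (Suc i)) \<and> ys ! i \<notin> P (Suc i)"
      using Cons.prems(3) by fastforce
  qed
  finally have A1: "sum T A1 \<notin> P 1" by simp
  \<comment> \<open>Terms outside \<open>A1\<close> keep a factor \<open>y\<close>, which lies in
    \<open>P 1\<close>.\<close>
  have "T \<alpha> \<in> P 1" if "\<alpha> \<in> A - A1" for \<alpha>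
  proof -
    have "hd \<alpha> - a0 \<noteq> 0"
      using that le[of \<alpha>] by (auto simp: A1_def)
    then obtain k where k: "hd \<alpha> - a0 = Suc k"
      using not0_implies_Suc by blast
    have "T \<alpha> = (Poly_Mapping.single 0 (c \<alpha>) * (y ^ k * power_product ys (tl \<alpha>))) * y"
      by (simp add: T_def k ac_simps)
    also have "\<dots> \<in> P 1"
      using carr y by (intro ideal_times[OF ideal(2)] carrier_times const_in_carrier carrier_power power_product_in_carrier)
    finally show ?thesis .
  qed
  then have rest: "sum T (A - A1) \<in> P 1"
    by (rule ideal_sum[OF ideal(2)])
  show ?case
  proof
    assume "(\<Sum>\<alpha>\<in>A. Poly_Mapping.single 0 (c \<alpha>) * power_product (y # ys) \<alpha>) \<in> P 0"
    \<comment> \<open>The power of \<open>y\<close> is cancelled by primality, as \<open>y\<close>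
      is not in \<open>P 0\<close>.\<close>
    then have "y ^ a0 \<in> P 0 \<or> sum T A \<in> P 0"
      unfolding factor using T carr by (intro prime_times[OF prime(1)] carrier_power carrier_sum)
    then have "sum T A \<in> P 1"
      using prime_power[OF prime(1) _ carr(1)] y P01 by blast
    moreover have "sum T A1 = sum T A - sum T (A - A1)"
      using sum.subset_diff[of A1 A T] Cons.prems(4) by (simp add: A1_def)
    ultimately show False
      using ideal_minus[OF ideal(2) _ rest] A1 by metis
  qed
qed

text \<open>For empty \<open>V\<close> this bounds the dimension of the polynomial ring itself. In
  general the polynomials separating consecutive primes can be taken free of
  \<open>V\<close>.\<close>

lemma prime_chain_length_le:
  fixes P :: "nat \<Rightarrow> ((nat \<Rightarrow>\<^sub>0 nat) \<Rightarrow>\<^sub>0 'k::field) set"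
  assumes prime: "\<forall>i\<le>m. primeideal (P i) (poly_ring n)" and chain: "\<forall>i<m. P i \<subset> P (Suc i)"
    and V: "V \<subseteq> {1..n}" "\<forall>i\<in>V. var i \<in> P 0"
  shows "m \<le> n - card V"
proof (rule ccontr)
  assume "\<not> m \<le> n - card V"
  moreover define W where "W = {1..n} - V"
  ultimately have W: "finite W" "card W < m"
    using V(1) by (auto simp: card_Diff_subset finite_subset)
  have mono: "P 0 \<subseteq> P i" if "i \<le> m" for i
    using that
  proof (induction i)
    case (Suc i)
    then show ?case using chain[rule_format, of i] by auto
  qed simp
  have "\<exists>y. y \<in> P (Suc i) \<and> y \<notin> P i \<and> (\<forall>w\<in>Poly_Mapping.keys y. Poly_Mapping.keys w \<subseteq> W)" if i: "i < m" for i
  proof -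
    have ideal: "ideal (P i) (poly_ring n)" "ideal (P (Suc i)) (poly_ring n)"
      using prime i by (simp_all add: primeideal.axioms(1))
    obtain p where p: "p \<in> P (Suc i)" "p \<notin> P i"
      using chain i by blast
    obtain r s where rs: "p = r + s" "r \<in> carrier (poly_ring n)" "s \<in> var_ideal n V"
        "\<forall>w\<in>Poly_Mapping.keys r. Poly_Mapping.keys w \<inter> V = {}"
      using split_by_variables[OF ideal_carrier[OF ideal(2) p(1)]] by blast
    \<comment> \<open>Every member of the chain contains the variables in \<open>V\<close>, so
      removing the terms that involve them does not affect membership in \<open>P i\<close> or
      \<open>P (Suc i)\<close>.\<close>
    have s: "s \<in> P i"
    proof (rule ideal_polyI[OF ideal(1)])
      fix w assume "w \<in> Poly_Mapping.keys s"
      then have "Poly_Mapping.keys w \<subseteq> {1..n}" "Poly_Mapping.keys w \<inter> V \<noteq> {}"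
        using rs(3) by (auto simp: monomial_span_def mem_carrier_poly_ring)
      then show "monomial w \<in> P i"
        using monomial_in_ideal[OF ideal(1)] V(2) mono[of i] i by fastforce
    qed
    have "r = p - s" using rs(1) by simp
    moreover have "s \<in> P (Suc i)" using s chain i by blast
    ultimately have "r \<in> P (Suc i)"
      using ideal_minus[OF ideal(2) p(1)] by simp
    moreover have "r \<notin> P i"
      using ideal_plus[OF ideal(1) _ s] p(2) rs(1) by blast
    moreover have "\<forall>w\<in>Poly_Mapping.keys r. Poly_Mapping.keys w \<subseteq> W"
      using rs(2,4) unfolding W_def mem_carrier_poly_ring by blast
    ultimately show ?thesis by blast
  qed
  then obtain y where y: "\<And>i. i < m \<Longrightarrow> y i \<in> P (Suc i) \<and> y i \<notin> P i \<and> (\<forall>w\<in>Poly_Mapping.keys (y i). Poly_Mapping.keys w \<subseteq> W)"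
    by metis
  define ys where "ys = map y [0..<m]"
  obtain A c where A: "finite A" "A \<noteq> {}" "\<forall>\<alpha>\<in>A. length \<alpha> = length ys \<and> c \<alpha> \<noteq> 0"
    "(\<Sum>\<alpha>\<in>A. Poly_Mapping.single 0 (c \<alpha>) * power_product ys \<alpha>) = 0"
    using algebraic_dependence[of W ys] W y by (auto simp: ys_def)
  have "(\<Sum>\<alpha>\<in>A. Poly_Mapping.single 0 (c \<alpha>) * power_product ys \<alpha>) \<notin> P 0"
    using prime chain y by (intro no_relation_along_chain[OF _ _ _ A(1-3)]) (auto simp: ys_def)
  then show False
    using A(4) ideal_zero[OF primeideal.axioms(1)] prime by auto
qed

section \<open>Primes and chains of primes in a quotient ring\<close>

context ideal
begin

lemma contraction_from_quotient:
  assumes "cring R" and J: "primeideal J (R Quot I)"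
  shows "primeideal {r \<in> carrier R. I +> r \<in> J} R" "I \<subseteq> {r \<in> carrier R. I +> r \<in> J}"
proof -
  show "primeideal {r \<in> carrier R. I +> r \<in> J} R"
    using ring_hom_ring.primeideal_vimage[OF rcos_ring_hom_ring assms] .
  have "I \<in> J"
    using additive_subgroup.zero_closed[OF ideal.axioms(1)[OF primeideal.axioms(1)[OF J]]]
    by (simp add: FactRing_def)
  then show "I \<subseteq> {r \<in> carrier R. I +> r \<in> J}"
    using a_rcos_zero[OF ideal_axioms] a_subset by auto
qed

text \<open>As \<open>P\<close> contains \<open>I\<close>, it is a union of cosets of
  \<open>I\<close>.\<close>

lemma coset_in_image_iff:
  assumes "ideal P R" "I \<subseteq> P" "r \<in> carrier R"
  shows "I +> r \<in> (+>) I ` P \<longleftrightarrow> r \<in> P"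
proof
  assume "I +> r \<in> (+>) I ` P"
  then obtain p where p: "p \<in> P" "I +> r = I +> p"
    by blast
  then have "r \<in> I +> p"
    using a_rcos_self[OF assms(3)] by simp
  then obtain i where "i \<in> I" "r = i \<oplus> p"
    by (auto simp: a_r_coset_def')
  then show "r \<in> P"
    using assms(2) p(1) additive_subgroup.a_closed[OF ideal.axioms(1)[OF assms(1)]] by blast
qed blast

lemma primeideal_quotient_image:
  assumes P: "primeideal P R" "I \<subseteq> P"
  shows "primeideal ((+>) I ` P) (R Quot I)"
proof (rule primeidealI)
  interpret P: primeideal P R by (rule P)
  note iff = coset_in_image_iff[OF P.ideal_axioms P(2)]
  have carrier: "carrier (R Quot I) = (+>) I ` carrier R"
    by (auto simp: FactRing_def A_RCOSETS_def')
  show "ideal ((+>) I ` P) (R Quot I)"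
    by (rule ring_ideal_imp_quot_ideal[OF ideal_axioms P.ideal_axioms])
  show "cring (R Quot I)"
    by (rule quotient_is_cring[OF P.is_cring])
  have "\<one> \<notin> P"
    using P.one_imp_carrier P.I_notcarr by auto
  then show "carrier (R Quot I) \<noteq> (+>) I ` P"
    using iff[OF one_closed] one_closed unfolding carrier by blast
  fix a b
  assume "a \<in> carrier (R Quot I)" "b \<in> carrier (R Quot I)" and ab: "a \<otimes>\<^bsub>R Quot I\<^esub> b \<in> (+>) I ` P"
  then obtain x y where xy: "x \<in> carrier R" "y \<in> carrier R" "a = I +> x" "b = I +> y"
    unfolding carrier by blast
  then have "I +> (x \<otimes> y) \<in> (+>) I ` P"
    using ab by (simp add: FactRing_def rcoset_mult_add)
  then have "x \<in> P \<or> y \<in> P"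
    using iff xy P.I_prime by simp
  then show "a \<in> (+>) I ` P \<or> b \<in> (+>) I ` P"
    using xy by blast
qed

text \<open>Contracting a chain to \<open>R\<close> keeps it strict, since every element of the
  quotient has a representative.\<close>

lemma krull_dim_quotient_le:
  assumes "cring R"
    and bound: "\<And>m P. \<forall>i\<le>m. primeideal (P i) R \<Longrightarrow> \<forall>i<m. P i \<subset> P (Suc i) \<Longrightarrow> I \<subseteq> P 0 \<Longrightarrow> m \<le> k"
  shows "krull_dim (R Quot I) \<le> ereal (real k)"
  unfolding krull_dim_def
proof (rule Sup_least, clarify)
  fix m and P :: "nat \<Rightarrow> 'a set set"
  assume P: "\<forall>i\<le>m. primeideal (P i) (R Quot I)" "\<forall>i<m. P i \<subset> P (Suc i)"
  define Q where "Q i = {r \<in> carrier R. I +> r \<in> P i}" for i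
  have "Q i \<subset> Q (Suc i)" if i: "i < m" for i
  proof -
    obtain X where X: "X \<in> P (Suc i)" "X \<notin> P i"
      using P(2) i by blast
    have "P (Suc i) \<subseteq> carrier (R Quot I)"
      using P(1) i additive_subgroup.a_subset[OF ideal.axioms(1)[OF primeideal.axioms(1)]]
      by (meson Suc_leI)
    then obtain x where "x \<in> carrier R" "X = I +> x"
      using X(1) by (auto simp: FactRing_def A_RCOSETS_def')
    then show ?thesis
      using X P(2) i unfolding Q_def by blast
  qed
  moreover have "primeideal (Q i) R" "I \<subseteq> Q i" if "i \<le> m" for i
    using contraction_from_quotient[OF assms(1), of "P i"] P(1) that unfolding Q_def by blast+
  ultimately have "m \<le> k"
    by (intro bound[of m Q]) auto
  then show "ereal (real m) \<le> ereal (real k)"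
    by simp
qed

text \<open>Images of primes above \<open>I\<close> stay prime and distinct, as each is recovered
  from its image by \<open>coset_in_image_iff\<close>.\<close>

lemma krull_dim_quotient_ge:
  assumes P: "\<forall>i\<le>m. primeideal (P i) R" "\<forall>i<m. P i \<subset> P (Suc i)" "\<forall>i\<le>m. I \<subseteq> P i"
  shows "ereal (real m) \<le> krull_dim (R Quot I)"
  unfolding krull_dim_def
proof (rule Sup_upper, rule CollectI, rule exI[of _ m], intro exI conjI refl allI impI)
  fix i
  show "primeideal ((+>) I ` P i) (R Quot I)" if "i \<le> m"
    using P that by (intro primeideal_quotient_image) auto
  show "(+>) I ` P i \<subset> (+>) I ` P (Suc i)" if i: "i < m"
  proof -
    have ideal: "ideal (P i) R" "ideal (P (Suc i)) R"
      using P(1) i by (simp_all add: primeideal.axioms(1))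
    obtain x where x: "x \<in> P (Suc i)" "x \<notin> P i"
      using P(2) i by blast
    then have "x \<in> carrier R"
      using additive_subgroup.a_subset[OF ideal.axioms(1)[OF ideal(2)]] by blast
    then have "I +> x \<notin> (+>) I ` P i"
      using coset_in_image_iff[OF ideal(1)] P(3) i x by simp
    then show ?thesis
      using P(2) i x by blast
  qed
qed

end

section \<open>Dimension bounds in terms of variables\<close>

lemma var_in_var_ideal_iff:
  assumes "i \<in> {1..n}"
  shows "(var i :: (nat \<Rightarrow>\<^sub>0 nat) \<Rightarrow>\<^sub>0 'k::field) \<in> var_ideal n V \<longleftrightarrow> i \<in> V"
proof -
  have "(var i :: (nat \<Rightarrow>\<^sub>0 nat) \<Rightarrow>\<^sub>0 'k) \<in> carrier (poly_ring n)"
    using assms by (simp add: var_def)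
  then show ?thesis
    by (simp add: monomial_span_def var_def monomial_def)
qed

lemma monomial_in_monomial_span_iff:
  "(monomial w :: (nat \<Rightarrow>\<^sub>0 nat) \<Rightarrow>\<^sub>0 'k::field) \<in> monomial_span n S \<longleftrightarrow> Poly_Mapping.keys w \<subseteq> {1..n} \<and> w \<in> S"
  unfolding monomial_span_def by (auto simp: mem_carrier_poly_ring monomial_def)

lemma krull_dim_ge_of_subset_var_ideal:
  fixes I :: "((nat \<Rightarrow>\<^sub>0 nat) \<Rightarrow>\<^sub>0 'k::field) set"
  assumes I: "ideal I (poly_ring n)" "I \<subseteq> var_ideal n V" and V: "V \<subseteq> {1..n}"
  shows "ereal (real (n - card V)) \<le> krull_dim (poly_ring n Quot I)"
proof -
  have fin: "finite ({1..n} - V)" by simp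
  \<comment> \<open>The enumeration \<open>e\<close> fixes the order in which the variables outside
    \<open>V\<close> are adjoined to obtain a chain.\<close>
  obtain e where e: "bij_betw e {..<n - card V} ({1..n} - V)"
    using ex_bij_betw_nat_finite[OF fin] V by (auto simp: card_Diff_subset finite_subset atLeast0LessThan)
  define P :: "nat \<Rightarrow> ((nat \<Rightarrow>\<^sub>0 nat) \<Rightarrow>\<^sub>0 'k) set" where "P i = var_ideal n (V \<union> e ` {..<i})" for i
  have mono: "V' \<subseteq> V'' \<Longrightarrow> var_ideal n V' \<subseteq> (var_ideal n V'' :: ((nat \<Rightarrow>\<^sub>0 nat) \<Rightarrow>\<^sub>0 'k) set)" for V' V''
    unfolding monomial_span_def by blast
  have "P i \<subset> P (Suc i)" if i: "i < n - card V" for i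
  proof -
    have ei: "e i \<in> {1..n} - V"
      using bij_betwE[OF e] i by simp
    have "e i \<notin> e ` {..<i}"
      using i bij_betw_imp_inj_on[OF e] by (auto dest!: inj_onD)
    then have "var (e i) \<in> P (Suc i)" "var (e i) \<notin> P i"
      using ei unfolding P_def by (subst var_in_var_ideal_iff; auto)+
    moreover have "P i \<subseteq> P (Suc i)"
      unfolding P_def by (rule mono) auto
    ultimately show ?thesis by blast
  qed
  moreover have "I \<subseteq> P i" for i
    using I(2) mono[of V "V \<union> e ` {..<i}"] unfolding P_def by blast
  ultimately show ?thesis
    by (intro ideal.krull_dim_quotient_ge[OF I(1), of _ P]) (auto simp: P_def prime_var_ideal)
qed

text \<open>The set of variables may vary with the prime. Only its size matters, because each chain
  is bounded through its own first member.\<close>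

lemma krull_dim_le_of_prime_vars:
  fixes I :: "((nat \<Rightarrow>\<^sub>0 nat) \<Rightarrow>\<^sub>0 'k::field) set"
  assumes I: "ideal I (poly_ring n)"
    and vars: "\<And>P. primeideal P (poly_ring n) \<Longrightarrow> I \<subseteq> P \<Longrightarrow> \<exists>V\<subseteq>{1..n}. card V = k \<and> (\<forall>i\<in>V. var i \<in> P)"
  shows "krull_dim (poly_ring n Quot I) \<le> ereal (real (n - k))"
proof (rule ideal.krull_dim_quotient_le[OF I cring_poly_ring])
  fix m and P :: "nat \<Rightarrow> ((nat \<Rightarrow>\<^sub>0 nat) \<Rightarrow>\<^sub>0 'k) set"
  assume P: "\<forall>i\<le>m. primeideal (P i) (poly_ring n)" "\<forall>i<m. P i \<subset> P (Suc i)" "I \<subseteq> P 0"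
  then obtain V where "V \<subseteq> {1..n}" "card V = k" "\<forall>i\<in>V. var i \<in> P 0"
    using vars[of "P 0"] by auto
  then show "m \<le> n - k"
    using prime_chain_length_le[OF P(1,2), of V] by simp
qed

section \<open>Powers of the maximal ideal\<close>

text \<open>Powers are formed in \<open>ideals_set\<close>, whose unit is the whole ring and whose
  multiplication is the ideal product.\<close>

lemma ideal_power_0: "Q [^]\<^bsub>ideals_set R\<^esub> (0::nat) = carrier R"
  and ideal_power_Suc: "Q [^]\<^bsub>ideals_set R\<^esub> Suc d = (Q [^]\<^bsub>ideals_set R\<^esub> d) \<cdot>\<^bsub>R\<^esub> Q"
  by (simp_all add: nat_pow_def ideals_set_def)

lemma max_ideal_eq: "(max_ideal n :: ((nat \<Rightarrow>\<^sub>0 nat) \<Rightarrow>\<^sub>0 'k::field) set) = monomial_span n {w. total_degree n w \<ge> 1}"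
proof -
  let ?R = "poly_ring n :: ((nat \<Rightarrow>\<^sub>0 nat) \<Rightarrow>\<^sub>0 'k) ring"
  let ?G = "monomial_span n {w. total_degree n w \<ge> 1} :: ((nat \<Rightarrow>\<^sub>0 nat) \<Rightarrow>\<^sub>0 'k) set"
  let ?m = "max_ideal n :: ((nat \<Rightarrow>\<^sub>0 nat) \<Rightarrow>\<^sub>0 'k) set"
  interpret cring ?R by (rule cring_poly_ring)
  have vars: "var ` {1..n} \<subseteq> carrier ?R"
    by (auto simp: var_def)
  have m: "ideal ?m ?R"
    unfolding max_ideal_def by (rule genideal_ideal[OF vars])
  have G: "ideal ?G ?R"
    by (rule ideal_monomial_span) (simp add: total_degree_add)
  have "var i \<in> ?G" if "i \<in> {1..n}" for i
    unfolding var_def monomial_in_monomial_span_iff using that total_degree_single[of n i 1] by simp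
  then have "?m \<subseteq> ?G"
    unfolding max_ideal_def by (intro genideal_minimal[OF G]) blast
  moreover have "p \<in> ?m" if p: "p \<in> ?G" for p
  proof (rule ideal_polyI[OF m])
    fix w assume "w \<in> Poly_Mapping.keys p"
    then have w: "Poly_Mapping.keys w \<subseteq> {1..n}" "total_degree n w \<ge> 1"
      using p by (auto simp: monomial_span_def mem_carrier_poly_ring)
    then have "w \<noteq> 0" by auto
    then obtain i where i: "i \<in> Poly_Mapping.keys w"
      by (metis ex_in_conv keys_eq_empty)
    have "var i \<in> ?m"
      using genideal_self[OF vars] i w(1) unfolding max_ideal_def by blast
    then show "monomial w \<in> ?m"
      by (rule monomial_in_ideal[OF m w(1) i])
  qed
  ultimately show "?m = ?G" by blast
qed

text \<open>Degrees add under multiplication, which gives one inclusion; splitting a variable off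
  each monomial gives the other.\<close>

lemma max_ideal_power_eq:
  "(max_ideal n [^]\<^bsub>ideals_set (poly_ring n)\<^esub> d :: ((nat \<Rightarrow>\<^sub>0 nat) \<Rightarrow>\<^sub>0 'k::field) set) =
    monomial_span n {w. total_degree n w \<ge> d}"
proof (induction d)
  case 0
  show ?case
    unfolding ideal_power_0 monomial_span_def by simp
next
  case (Suc d)
  let ?R = "poly_ring n :: ((nat \<Rightarrow>\<^sub>0 nat) \<Rightarrow>\<^sub>0 'k) ring"
  let ?G = "\<lambda>d. monomial_span n {w. total_degree n w \<ge> d} :: ((nat \<Rightarrow>\<^sub>0 nat) \<Rightarrow>\<^sub>0 'k) set"
  interpret cring ?R by (rule cring_poly_ring)
  have G: "ideal (?G e) ?R" for e
    by (rule ideal_monomial_span) (simp add: total_degree_add)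
  have "p \<in> ?G (Suc d)" if "p \<in> ?G d \<cdot>\<^bsub>?R\<^esub> ?G 1" for p
    using that
  proof (induction rule: ideal_prod.induct)
    case (prod p q)
    have "total_degree n w \<ge> Suc d" if "w \<in> Poly_Mapping.keys (p * q)" for w
    proof -
      obtain a b where "w = a + b" "a \<in> Poly_Mapping.keys p" "b \<in> Poly_Mapping.keys q"
        using \<open>w \<in> Poly_Mapping.keys (p * q)\<close> keys_mult[of p q] by blast
      moreover have "total_degree n a \<ge> d" "total_degree n b \<ge> 1"
        using calculation prod by (auto simp: monomial_span_def)
      ultimately show ?thesis
        using total_degree_add[of n a b] by simp
    qed
    moreover have "p * q \<in> carrier ?R"
      using prod by (intro carrier_times) (auto simp: monomial_span_def)
    ultimately show ?case
      by (auto simp: monomial_span_def)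
  next
    case (sum p q)
    then show ?case
      using ideal_plus[OF G] by simp
  qed
  moreover have "p \<in> ?G d \<cdot>\<^bsub>?R\<^esub> ?G 1" if p: "p \<in> ?G (Suc d)" for p
  proof (rule ideal_polyI[OF ideal_prod_is_ideal[OF G G]])
    fix w assume "w \<in> Poly_Mapping.keys p"
    then have w: "Poly_Mapping.keys w \<subseteq> {1..n}" "total_degree n w \<ge> Suc d"
      using p by (auto simp: monomial_span_def mem_carrier_poly_ring)
    then have "w \<noteq> 0" by auto
    then obtain i where i: "i \<in> Poly_Mapping.keys w"
      by (metis ex_in_conv keys_eq_empty)
    then have "i \<in> {1..n}" using w(1) by blast
    then have "total_degree n (Poly_Mapping.single i 1) = 1"
      using total_degree_single[of n i 1] by simp
    moreover have "total_degree n w = total_degree n (Poly_Mapping.single i 1) + total_degree n (w - Poly_Mapping.single i 1)"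
      using monomial_split[OF i] total_degree_add[of n "Poly_Mapping.single i 1" "w - Poly_Mapping.single i 1"] by simp
    ultimately have "monomial (w - Poly_Mapping.single i 1) \<in> ?G d" "var i \<in> ?G 1"
      using w \<open>i \<in> {1..n}\<close> keys_minus_subset[of w "Poly_Mapping.single i 1"]
      unfolding var_def monomial_in_monomial_span_iff by auto
    then have "monomial (w - Poly_Mapping.single i 1) \<otimes>\<^bsub>?R\<^esub> var i \<in> ?G d \<cdot>\<^bsub>?R\<^esub> ?G 1"
      by (rule ideal_prod.prod)
    moreover have "monomial (w - Poly_Mapping.single i 1) \<otimes>\<^bsub>?R\<^esub> var i = monomial w"
      unfolding monomial_eq_var_times[OF i] by (simp add: mult.commute)
    ultimately show "monomial w \<in> ?G d \<cdot>\<^bsub>?R\<^esub> ?G 1"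
      by simp
  qed
  ultimately show ?case
    unfolding ideal_power_Suc Suc.IH unfolding max_ideal_eq by blast
qed

section \<open>Lexicographic comparison of monomials of equal degree\<close>

lemma monomials_of_degree_iff:
  "w \<in> monomials_of_degree n d \<longleftrightarrow> Poly_Mapping.keys w \<subseteq> {1..n} \<and> total_degree n w = d"
  by (simp add: monomials_of_degree_def total_degree_def)

text \<open>The source of contradiction in the comparisons below: a monomial cannot properly divide
  another of the same degree.\<close>

lemma total_degree_less:
  assumes "\<And>j. Poly_Mapping.lookup w j \<le> Poly_Mapping.lookup w' j" "k \<in> {1..n}" "Poly_Mapping.lookup w k < Poly_Mapping.lookup w' k"
  shows "total_degree n w < total_degree n w'"
  unfolding total_degree_def using assms by (intro sum_strict_mono_ex1) auto

lemma single_in_monomials_of_degree: "i \<in> {1..n} \<Longrightarrow> Poly_Mapping.single i d \<in> monomials_of_degree n d"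
  using total_degree_single[of n i d] by (auto simp: monomials_of_degree_iff)

lemma lookup_eq_0_of_keys: "Poly_Mapping.keys w \<subseteq> A \<Longrightarrow> i \<notin> A \<Longrightarrow> Poly_Mapping.lookup w i = 0"
  by (auto simp: in_keys_iff)

text \<open>If \<open>v\<close> were larger, its exponent would be larger at the first difference
  \<open>k\<close>. Since \<open>k\<close> is at least \<open>i\<close>, the pure power vanishes
  beyond \<open>k\<close> and would properly divide \<open>v\<close>.\<close>

lemma le_pure_power:
  assumes v: "v \<in> monomials_of_degree n d" "Poly_Mapping.keys v \<subseteq> {q..n}" and i: "1 \<le> i" "i \<le> q" "q \<le> n"
  shows "v \<le> Poly_Mapping.single i d"
proof (rule ccontr)
  assume "\<not> v \<le> Poly_Mapping.single i d"
  then have "Poly_Mapping.single i d < v" by simp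
  then obtain k where k: "Poly_Mapping.lookup (Poly_Mapping.single i d) k < Poly_Mapping.lookup v k"
      "\<And>j. j < k \<Longrightarrow> Poly_Mapping.lookup (Poly_Mapping.single i d) j = Poly_Mapping.lookup v j"
    unfolding monomial_less_iff by blast
  then have "k \<in> Poly_Mapping.keys v" by (simp add: in_keys_iff)
  then have kq: "q \<le> k" "k \<in> {1..n}" using v i by auto
  have "Poly_Mapping.lookup (Poly_Mapping.single i d) j \<le> Poly_Mapping.lookup v j" for j
    using k(1) k(2)[of j] i kq by (cases "j < k"; cases "j = k") (auto simp: lookup_single when_def)
  then have "total_degree n (Poly_Mapping.single i d) < total_degree n v"
    using k(1) kq(2) by (intro total_degree_less)
  then show False
    using v(1) i total_degree_single[of n i d] by (simp add: monomials_of_degree_iff)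
qed

text \<open>The comparison is decided at index 1; index 0 precedes it in the order and must be seen
  to have exponent 0.\<close>

lemma pure_power_less:
  fixes u :: "nat \<Rightarrow>\<^sub>0 nat"
  assumes "Poly_Mapping.keys u \<subseteq> {1..n}" "Poly_Mapping.lookup u 1 > 0" "1 < i"
  shows "Poly_Mapping.single i d < u"
  unfolding monomial_less_iff
  using assms lookup_eq_0_of_keys[OF assms(1), of 0] by (intro exI[of _ 1]) (auto simp: lookup_single when_def)

text \<open>A smaller \<open>w\<close> could first differ only at \<open>n\<close>, and would then
  properly divide the pure power.\<close>

lemma last_pure_power_le:
  assumes w: "w \<in> monomials_of_degree n d" and n: "1 \<le> n"
  shows "Poly_Mapping.single n d \<le> w"
proof (rule ccontr)
  assume "\<not> Poly_Mapping.single n d \<le> w"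
  then have "w < Poly_Mapping.single n d" by simp
  then obtain k where k: "Poly_Mapping.lookup w k < Poly_Mapping.lookup (Poly_Mapping.single n d) k"
      "\<And>j. j < k \<Longrightarrow> Poly_Mapping.lookup w j = Poly_Mapping.lookup (Poly_Mapping.single n d) j"
    unfolding monomial_less_iff by blast
  then have kn: "k = n" by (auto simp: lookup_single when_def split: if_splits)
  have "Poly_Mapping.lookup w j \<le> Poly_Mapping.lookup (Poly_Mapping.single n d) j" for j
    using k(1) k(2)[of j] kn lookup_eq_0_of_keys[of w "{1..n}" j] w
    by (cases "j < n"; cases "j = n") (auto simp: monomials_of_degree_iff)
  then have "total_degree n w < total_degree n (Poly_Mapping.single n d)"
    using k(1) kn n by (intro total_degree_less) auto
  then show False
    using w n total_degree_single[of n n d] by (simp add: monomials_of_degree_iff)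
qed

text \<open>A smaller \<open>u\<close> that still involves the first variable would first differ at
  \<open>n\<close>, hence be a proper divisor.\<close>

lemma least_multiple_of_first_var:
  assumes u: "u \<in> monomials_of_degree n d" "Poly_Mapping.lookup u 1 > 0" and n: "1 < n" and d: "1 \<le> d"
  shows "Poly_Mapping.single 1 1 + Poly_Mapping.single n (d - 1) \<le> u"
proof (rule ccontr)
  let ?w = "Poly_Mapping.single 1 1 + Poly_Mapping.single n (d - 1) :: nat \<Rightarrow>\<^sub>0 nat"
  assume "\<not> ?w \<le> u"
  then have "u < ?w" by simp
  then obtain k where k: "Poly_Mapping.lookup u k < Poly_Mapping.lookup ?w k"
      "\<And>j. j < k \<Longrightarrow> Poly_Mapping.lookup u j = Poly_Mapping.lookup ?w j"
    unfolding monomial_less_iff by blast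
  then have kn: "k = n"
    using u(2) n by (auto simp: lookup_add lookup_single when_def split: if_splits)
  have "Poly_Mapping.lookup u j \<le> Poly_Mapping.lookup ?w j" for j
    using k(1) k(2)[of j] kn lookup_eq_0_of_keys[of u "{1..n}" j] u
    by (cases "j < n"; cases "j = n") (auto simp: monomials_of_degree_iff)
  then have "total_degree n u < total_degree n ?w"
    using k(1) kn n by (intro total_degree_less) auto
  also have "\<dots> = d"
    unfolding total_degree_add using n d by (simp add: total_degree_single)
  finally show False
    using u(1) by (simp add: monomials_of_degree_iff)
qed

text \<open>A monomial in variables beyond \<open>q\<close> agrees with \<open>v\<close> before
  \<open>q\<close> and has the smaller exponent at \<open>q\<close>, so it lies below
  \<open>v\<close>.\<close>

lemma keys_meet_of_le:
  fixes v w :: "nat \<Rightarrow>\<^sub>0 nat"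
  assumes "Poly_Mapping.keys v \<subseteq> {q..n}" "Poly_Mapping.lookup v q > 0" "v \<le> w"
  shows "Poly_Mapping.keys w \<inter> {..q} \<noteq> {}"
proof
  assume "Poly_Mapping.keys w \<inter> {..q} = {}"
  then have w: "Poly_Mapping.lookup w j = 0" if "j \<le> q" for j
    using that by (auto simp: in_keys_iff)
  have "Poly_Mapping.lookup w j = Poly_Mapping.lookup v j" if "j < q" for j
    using w[of j] lookup_eq_0_of_keys[OF assms(1), of j] that by simp
  then have "w < v"
    unfolding monomial_less_iff using w[of q] assms(2) by (intro exI[of _ q]) simp
  then show False
    using assms(3) by simp
qed

text \<open>This puts the power of the maximal ideal into the shape of a lexsegment ideal. A
  monomial of larger degree is reduced to degree \<open>d\<close> one variable at a time.\<close>

lemma max_ideal_power_eq_genideal: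
  "(max_ideal n [^]\<^bsub>ideals_set (poly_ring n)\<^esub> d :: ((nat \<Rightarrow>\<^sub>0 nat) \<Rightarrow>\<^sub>0 'k::field) set) =
    Idl\<^bsub>poly_ring n\<^esub> (monomial ` monomials_of_degree n d)"
proof -
  let ?R = "poly_ring n :: ((nat \<Rightarrow>\<^sub>0 nat) \<Rightarrow>\<^sub>0 'k) ring"
  let ?G = "monomial_span n {w. total_degree n w \<ge> d} :: ((nat \<Rightarrow>\<^sub>0 nat) \<Rightarrow>\<^sub>0 'k) set"
  let ?I = "Idl\<^bsub>?R\<^esub> (monomial ` monomials_of_degree n d)"
  interpret cring ?R by (rule cring_poly_ring)
  have carr: "monomial ` monomials_of_degree n d \<subseteq> carrier ?R"
    by (auto simp: monomials_of_degree_iff)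
  note I = genideal_ideal[OF carr]
  have G: "ideal ?G ?R"
    by (rule ideal_monomial_span) (simp add: total_degree_add)
  have "?I \<subseteq> ?G"
    by (intro genideal_minimal[OF G]) (auto simp: monomial_in_monomial_span_iff monomials_of_degree_iff)
  moreover have mon: "monomial w \<in> ?I" if "Poly_Mapping.keys w \<subseteq> {1..n}" "total_degree n w \<ge> d" for w
    using that
  proof (induction "total_degree n w" arbitrary: w rule: less_induct)
    case less
    show ?case
    proof (cases "total_degree n w = d")
      case True
      then show ?thesis
        using genideal_self[OF carr] less.prems by (auto simp: monomials_of_degree_iff)
    next
      case False
      then have "w \<noteq> 0" using less.prems by auto
      then obtain i where i: "i \<in> Poly_Mapping.keys w"
        by (metis ex_in_conv keys_eq_empty)
      let ?w' = "w - Poly_Mapping.single i 1"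
      have "i \<in> {1..n}" using i less.prems by blast
      then have "total_degree n w = 1 + total_degree n ?w'"
        using monomial_split[OF i] total_degree_add[of n "Poly_Mapping.single i 1" ?w'] total_degree_single[of n i 1]
        by simp
      then have "monomial ?w' \<in> ?I"
        using False less.prems keys_minus_subset[of w "Poly_Mapping.single i 1"] by (intro less.hyps) auto
      moreover have "var i \<in> carrier ?R"
        using \<open>i \<in> {1..n}\<close> by (simp add: var_def)
      ultimately show ?thesis
        unfolding monomial_eq_var_times[OF i] by (rule ideal_times[OF I])
    qed
  qed
  moreover have "p \<in> ?I" if "p \<in> ?G" for p
  proof (rule ideal_polyI[OF I])
    fix w assume "w \<in> Poly_Mapping.keys p"
    then show "monomial w \<in> ?I"
      using mon[of w] \<open>p \<in> ?G\<close> by (auto simp: monomial_span_def mem_carrier_poly_ring)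
  qed
  ultimately show ?thesis
    unfolding max_ideal_power_eq by blast
qed

section \<open>The dimension formula for lexsegment ideals\<close>

theorem proposition3p1:
  fixes n d q :: nat
    and u v :: "nat \<Rightarrow>\<^sub>0 nat"
    and I :: "((nat \<Rightarrow>\<^sub>0 nat) \<Rightarrow>\<^sub>0 'k::field) set"
  assumes "2 \<le> d"
    and "1 \<le> q" and "q \<le> n"
    and "u \<in> monomials_of_degree n d"
    and "v \<in> monomials_of_degree n d"
    and "Poly_Mapping.lookup u 1 > 0"
    and "Poly_Mapping.keys v \<subseteq> {q..n}"
    and "Poly_Mapping.lookup v q > 0"
    and "v \<le> u"
    and "I = lexsegment_ideal n d u v"
    and "I \<noteq> max_ideal n [^]\<^bsub>ideals_set (poly_ring n)\<^esub> d"
  shows "krull_dim (poly_ring n Quot I) = (if q < n then ereal (real (n - q)) else 1)"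
proof -
  let ?R = "poly_ring n :: ((nat \<Rightarrow>\<^sub>0 nat) \<Rightarrow>\<^sub>0 'k) ring"
  let ?L = "lexsegment n d u v"
  interpret cring ?R by (rule cring_poly_ring)
  have L: "w \<in> ?L \<longleftrightarrow> w \<in> monomials_of_degree n d \<and> v \<le> w \<and> w \<le> u" for w
    by (simp add: lexsegment_def)
  have keysL: "Poly_Mapping.keys w \<subseteq> {1..n}" if "w \<in> ?L" for w
    using that by (simp add: L monomials_of_degree_iff)
  have carr: "monomial ` ?L \<subseteq> carrier ?R"
    using keysL by auto
  have I_def: "I = Idl\<^bsub>?R\<^esub> (monomial ` ?L)"
    using assms(10) by (simp add: lexsegment_ideal_def)
  have I: "ideal I ?R"
    unfolding I_def by (rule genideal_ideal[OF carr])
  have "u \<in> ?L"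
    using assms by (simp add: L)
  have I_sub: "I \<subseteq> var_ideal n V" if "\<And>w. w \<in> ?L \<Longrightarrow> Poly_Mapping.keys w \<inter> V \<noteq> {}" for V
    unfolding I_def using that keysL
    by (intro genideal_minimal[OF ideal_var_ideal]) (auto simp: monomial_in_monomial_span_iff)
  have var_in: "\<exists>i\<in>Poly_Mapping.keys w. var i \<in> P" if "primeideal P ?R" "I \<subseteq> P" "w \<in> ?L" for P w
    using genideal_self[OF carr] that keysL by (intro prime_monomial[OF that(1)]) (auto simp: I_def)
  have pure: "var i \<in> P" if "primeideal P ?R" "I \<subseteq> P" "1 < i" "i \<le> q" for P i
  proof -
    have "Poly_Mapping.single i d \<in> ?L"
      using that assms le_pure_power[of v n d q i] pure_power_less[of u n i d]
      by (simp add: L single_in_monomials_of_degree monomials_of_degree_iff[of u])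
    then show ?thesis
      using var_in[OF that(1,2)] assms(1) by force
  qed
  show ?thesis
  proof (cases "q < n")
    case True
    have "Poly_Mapping.keys w \<inter> {1..q} \<noteq> {}" if "w \<in> ?L" for w
      using keys_meet_of_le[OF assms(7,8), of w] keysL[OF that] that by (fastforce simp: L)
    then have "ereal (real (n - card {1..q})) \<le> krull_dim (?R Quot I)"
      using True by (intro krull_dim_ge_of_subset_var_ideal I I_sub) auto
    moreover have "krull_dim (?R Quot I) \<le> ereal (real (n - q))"
    proof (rule krull_dim_le_of_prime_vars[OF I])
      fix P assume P: "primeideal P ?R" "I \<subseteq> P"
      show "\<exists>V\<subseteq>{1..n}. card V = q \<and> (\<forall>i\<in>V. var i \<in> P)"
      proof (cases "q = 1")
        \<comment> \<open>For \<open>q = 1\<close> the product of the first variable and a power of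
          the last may lie below \<open>v\<close>, so \<open>u\<close> supplies the variable
          instead.\<close>
        case True
        obtain i where "i \<in> Poly_Mapping.keys u" "var i \<in> P"
          using var_in[OF P \<open>u \<in> ?L\<close>] by blast
        then show ?thesis
          using keysL[OF \<open>u \<in> ?L\<close>] True by (intro exI[of _ "{i}"]) auto
      next
        case False
        then have q: "1 < q" using assms(2) by simp
        let ?w = "Poly_Mapping.single 1 1 + Poly_Mapping.single n (d - 1) :: nat \<Rightarrow>\<^sub>0 nat"
        have "Poly_Mapping.lookup v j = 0" if "j < q" for j
          using lookup_eq_0_of_keys[OF assms(7), of j] that by simp
        \<comment> \<open>For \<open>q > 1\<close> the first variable does not divide
          \<open>v\<close>, so index 1 decides.\<close>
        then have "v < ?w"
          unfolding monomial_less_iff using q True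
          by (intro exI[of _ 1]) (auto simp: lookup_add lookup_single when_def)
        moreover have "?w \<le> u"
          using assms True q by (intro least_multiple_of_first_var) auto
        moreover have "?w \<in> monomials_of_degree n d"
          using True q assms(1) total_degree_single[of n 1 1] total_degree_single[of n n "d - 1"]
          by (auto simp: monomials_of_degree_iff total_degree_add keys_plus_nat split: if_splits)
        ultimately have "?w \<in> ?L"
          by (simp add: L)
        then obtain i where "i \<in> Poly_Mapping.keys ?w" and i: "var i \<in> P"
          using var_in[OF P] by blast
        then have "i = 1 \<or> i = n"
          by (auto simp: keys_plus_nat split: if_splits)
        \<comment> \<open>Neither 1 nor \<open>n\<close> lies in \<open>{2..q}\<close>, as
          \<open>q < n\<close>; thus \<open>i\<close> really adds one variable.\<close>
        then have "insert i {2..q} \<subseteq> {1..n}" "card (insert i {2..q}) = q"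
          using True q by auto
        moreover have "\<forall>j\<in>insert i {2..q}. var j \<in> P"
          using i pure[OF P] by auto
        ultimately show ?thesis by blast
      qed
    qed
    ultimately show ?thesis
      using True by simp
  next
    case False
    then have q: "q = n" using assms(3) by simp
    have meet: "Poly_Mapping.keys w \<inter> {2..n} \<noteq> {}" if w: "w \<in> ?L" for w
    proof
      assume "Poly_Mapping.keys w \<inter> {2..n} = {}"
      then have "Poly_Mapping.keys w \<subseteq> {1}"
        using keysL[OF w] by force
      then have w1: "w = Poly_Mapping.single 1 (Poly_Mapping.lookup w 1)"
        by (intro poly_mapping_eqI) (auto simp: lookup_single when_def in_keys_iff)
      have "total_degree n w = d"
        using w by (simp add: L monomials_of_degree_iff)
      then have "Poly_Mapping.lookup w 1 = d"
        using w1 total_degree_single[of n 1 "Poly_Mapping.lookup w 1"] assms(2,3) by simp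
      then have wd: "w = Poly_Mapping.single 1 d"
        using w1 by simp
      \<comment> \<open>With the first pure power in the segment and \<open>v\<close> supported on
        the last variable, the segment has both extreme monomials of degree
        \<open>d\<close>.\<close>
      have "w' \<in> ?L" if w': "w' \<in> monomials_of_degree n d" for w'
      proof -
        have "v \<le> Poly_Mapping.single n d"
          using assms q by (intro le_pure_power[of v n d q]) auto
        also have "\<dots> \<le> w'"
          using last_pure_power_le[OF w'] assms(2,3) by simp
        finally have "v \<le> w'" .
        \<comment> \<open>\<open>le_pure_power\<close> with \<open>q\<close> and \<open>i\<close>
          both equal to 1 makes the pure power of the first variable the largest monomial.\<close>
        have "w' \<le> w"
          unfolding wd using w' assms(2,3) by (intro le_pure_power[of w' n d 1]) (auto simp: monomials_of_degree_iff)
        also have "w \<le> u"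
          using w by (simp add: L)
        finally show ?thesis
          using w' \<open>v \<le> w'\<close> by (simp add: L)
      qed
      then have "?L = monomials_of_degree n d"
        by (auto simp: L)
      then have "I = max_ideal n [^]\<^bsub>ideals_set ?R\<^esub> d"
        unfolding I_def max_ideal_power_eq_genideal by simp
      then show False
        using assms(11) by contradiction
    qed
    \<comment> \<open>The support of \<open>u\<close> meets \<open>{2..n}\<close>, so this interval
      is not empty; hence \<open>n - (n - 1)\<close> is 1.\<close>
    then have n: "2 \<le> n"
      using \<open>u \<in> ?L\<close> by fastforce
    have "ereal (real (n - card {2..n})) \<le> krull_dim (?R Quot I)"
      using meet by (intro krull_dim_ge_of_subset_var_ideal I I_sub) auto
    moreover have "krull_dim (?R Quot I) \<le> ereal (real (n - (n - 1)))"
    proof (rule krull_dim_le_of_prime_vars[OF I])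
      fix P assume "primeideal P ?R" "I \<subseteq> P"
      then show "\<exists>V\<subseteq>{1..n}. card V = n - 1 \<and> (\<forall>i\<in>V. var i \<in> P)"
        using pure q by (intro exI[of _ "{2..n}"]) auto
    qed
    ultimately show ?thesis
      using False n by (simp add: one_ereal_def)
  qed
qed

end
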